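(* Suppose that the probability density function $g(\omega)$ is even and $\max g(\omega)=g(0)$. If $\mathrm{Re}(f_1)=0$ and $\mathrm{Im}(f_1)=-1/2$ (which corresponds to the coupling function $f(\theta)=\sin\theta$), then the number $K_c^{(1)}$ is given by $$K_c^{(1)}=\frac{2}{\pi g(0)}.$$ When $K>K_c^{(1)}$, the solution $Z_1=0$ of the linear equation $\dfrac{dZ_1}{dt}=\left(\sqrt{-1}\,\mathcal{M}+\sqrt{-1}\,Kf_1\,\mathcal{P}\right)Z_1$ on $L^2(\mathbf{R},g(\omega)d\omega)$ is unstable.
   Context: $g$ is a probability density function on $\mathbf{R}$, and $K>0$ is a parameter (coupling strength). $f_1\in\mathbf{C}$ is the first Fourier coefficient of a real-valued $C^1$ $2\pi$-periodic function $f(\theta)=\sum_{l}f_l e^{\sqrt{-1}l\theta}$ with $f_0=0$. On the Hilbert space $L^2(\mathbf{R},g(\omega)d\omega)$, $\mathcal{M}:q(\omega)\mapsto\omega q(\omega)$ is the multiplication operator and $\mathcal{P}q(\omega)=\int_{\mathbf{R}}q(\omega)g(\omega)\,d\omega$ is the projection onto constants. Definition of $K_c^{(1)}$ (for $\mathrm{Im}(f_1)<0$): let $y_1,y_2,\dots$ be the real roots $y$ of $$\lim_{x\to 0}\int_{\mathbf{R}}\frac{\omega-y}{x^2+(\omega-y)^2}\,g(\omega)\,d\omega=\frac{\pi\,\mathrm{Re}(f_1)}{\mathrm{Im}(f_1)}\,g(y),$$ and put $$K_c^{(1)}:=\inf_n\frac{-\mathrm{Im}(f_1)}{\pi|f_1|^2\,g(y_n)}=\frac{-\mathrm{Im}(f_1)}{\pi|f_1|^2\,\sup_n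 g(y_n)},$$ where a quotient with $g(y_n)=0$ is understood as $+\infty$.
   Formalization: The instability claim for K > K_c^(1) is stated under the additional assumption that g is continuous at 0; without it, changing the value g(0) at a single point makes the claim false. The formula for K_c^(1) needs no such assumption. *)

theory Defs
  imports "HOL-Analysis.Analysis"
begin

definition fourier_coeff :: "(real \<Rightarrow> real) \<Rightarrow> int \<Rightarrow> complex" where
  "fourier_coeff f l =
     (1 / (2 * pi)) *\<^sub>R integral {0..2 * pi} (\<lambda>\<theta>. complex_of_real (f \<theta>) * cis (- (of_int l * \<theta>)))"

definition Kc_roots :: "(real \<Rightarrow> real) \<Rightarrow> complex \<Rightarrow> real set" where
  "Kc_roots g f1 =
     {y. ((\<lambda>x. LINT \<omega>|lborel. (\<omega> - y) / (x\<^sup>2 + (\<omega> - y)\<^sup>2) * g \<omega>)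
            \<longlongrightarrow> pi * Re f1 / Im f1 * g y) (at 0)}"

(* Only meant for Im f1 < 0.  Division in ereal gives a / 0 = \<infinity> for a > 0, which is the
   convention wanted at roots y with g y = 0. *)
definition Kc1 :: "(real \<Rightarrow> real) \<Rightarrow> complex \<Rightarrow> ereal" where
  "Kc1 g f1 =
     (INF y\<in>Kc_roots g f1. ereal (- Im f1) / ereal (pi * (cmod f1)\<^sup>2 * g y))"

definition freq_measure :: "(real \<Rightarrow> real) \<Rightarrow> real measure" where
  "freq_measure g = density lborel (\<lambda>\<omega>. ennreal (g \<omega>))"

(* Elements of L^2(R, g d\<omega>) are given by representatives: two functions are the same element
   iff the L2_norm of their difference is 0.  All notions below only depend on the classes. *)
definition L2 :: "(real \<Rightarrow> real) \<Rightarrow> (real \<Rightarrow> complex) set" where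
  "L2 g = {q \<in> borel_measurable borel. integrable (freq_measure g) (\<lambda>\<omega>. (cmod (q \<omega>))\<^sup>2)}"

definition L2_norm :: "(real \<Rightarrow> real) \<Rightarrow> (real \<Rightarrow> complex) \<Rightarrow> real" where
  "L2_norm g q = sqrt (LINT \<omega>|freq_measure g. (cmod (q \<omega>))\<^sup>2)"

definition mult_op :: "(real \<Rightarrow> complex) \<Rightarrow> real \<Rightarrow> complex" where
  "mult_op q = (\<lambda>\<omega>. complex_of_real \<omega> * q \<omega>)"

definition proj_op :: "(real \<Rightarrow> real) \<Rightarrow> (real \<Rightarrow> complex) \<Rightarrow> real \<Rightarrow> complex" where
  "proj_op g q = (\<lambda>_. LINT \<omega>|freq_measure g. q \<omega>)"

definition lin_op :: "(real \<Rightarrow> real) \<Rightarrow> real \<Rightarrow> complex \<Rightarrow> (real \<Rightarrow> complex) \<Rightarrow> real \<Rightarrow> complex" where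
  "lin_op g K f1 q = (\<lambda>\<omega>. \<i> * mult_op q \<omega> + \<i> * complex_of_real K * f1 * proj_op g q \<omega>)"

(* The multiplication operator is unbounded; lin_op has the same (maximal) domain, since the
   projection is bounded. *)
definition lin_dom :: "(real \<Rightarrow> real) \<Rightarrow> (real \<Rightarrow> complex) set" where
  "lin_dom g = {q \<in> L2 g. mult_op q \<in> L2 g}"

(* Classical solutions on [0, \<infinity>): Z t stays in the domain and Z is differentiable for the
   L^2 norm (one-sided at t = 0), with derivative lin_op applied to Z t. *)
definition lin_solution ::
  "(real \<Rightarrow> real) \<Rightarrow> real \<Rightarrow> complex \<Rightarrow> (real \<Rightarrow> real \<Rightarrow> complex) \<Rightarrow> bool" where
  "lin_solution g K f1 Z \<longleftrightarrow>
     (\<forall>t\<ge>0. Z t \<in> lin_dom g \<and>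
        ((\<lambda>s. L2_norm g (\<lambda>\<omega>. (Z s \<omega> - Z t \<omega>) / complex_of_real (s - t) - lin_op g K f1 (Z t) \<omega>))
           \<longlongrightarrow> 0) (at t within {0..}))"

definition zero_stable :: "(real \<Rightarrow> real) \<Rightarrow> real \<Rightarrow> complex \<Rightarrow> bool" where
  "zero_stable g K f1 \<longleftrightarrow>
     (\<forall>\<epsilon>>0. \<exists>\<delta>>0. \<forall>Z. lin_solution g K f1 Z \<longrightarrow> L2_norm g (Z 0) < \<delta> \<longrightarrow>
        (\<forall>t\<ge>0. L2_norm g (Z t) < \<epsilon>))"

definition zero_unstable :: "(real \<Rightarrow> real) \<Rightarrow> real \<Rightarrow> complex \<Rightarrow> bool" where
  "zero_unstable g K f1 \<longleftrightarrow> \<not> zero_stable g K f1"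

end

theory Submission
  imports Defs
begin

text \<open>For \<open>f\<^sub>1 = -\<i>/2\<close> an exponential solution \<open>exp (\<lambda> t) q\<close> with
  \<open>\<lambda> > 0\<close> exists as soon as \<open>q \<omega> = 1 / (\<lambda> - \<i> \<omega>)\<close> has mean \<open>2 / K\<close>. As \<open>g\<close> is even, that
  mean is the Poisson integral \<open>\<integral> \<lambda> / (\<lambda>\<^sup>2 + \<omega>\<^sup>2) g \<omega> d\<omega>\<close>. This is continuous in
  \<open>\<lambda> > 0\<close>, at most \<open>1 / \<lambda>\<close>, and, by continuity of \<open>g\<close> at \<open>0\<close>, exceeds every number below
  \<open>\<pi> g 0\<close> for small \<open>\<lambda>\<close>; so it takes the value \<open>2 / K\<close> when \<open>K > 2 / (\<pi> g 0)\<close>.\<close>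

section \<open>Odd integrands and the critical coupling\<close>

text \<open>Reflection in 0 negates the integral. Non-integrable \<open>h\<close> are covered too,
  since their integral is 0 by default.\<close>

lemma integral_odd_eq_0:
  fixes h :: "real \<Rightarrow> real"
  assumes "\<And>x. h (- x) = - h x"
  shows "(LINT x|lborel. h x) = 0"
proof -
  have "(LINT x|lborel. h x) = (LINT x|lborel. h (- x))"
    using lborel_integral_real_affine[of "-1" h 0] by simp
  then show ?thesis
    by (simp add: assms)
qed

text \<open>With \<open>Re f1 = 0\<close> the root equation has right-hand side 0, so evenness of
  \<open>g\<close> makes 0 a root; as \<open>g\<close> is largest there, this root gives the
  smallest quotient.\<close>

lemma Kc1_eq:
  assumes nonneg: "\<And>\<omega>. 0 \<le> g \<omega>" and even: "\<And>\<omega>. g (- \<omega>) = g \<omega>"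
    and max: "\<And>\<omega>. g \<omega> \<le> g 0" and pos: "0 < g 0"
    and f1: "Re f1 = 0" "Im f1 = - 1 / 2"
  shows "Kc1 g f1 = ereal (2 / (pi * g 0))"
proof -
  have "f1 = - \<i> / 2"
    by (simp add: complex_eq_iff f1)
  then have cmod: "cmod f1 = 1 / 2"
    by (simp add: norm_divide)
  have "(LINT \<omega>|lborel. (\<omega> - 0) / (x\<^sup>2 + (\<omega> - 0)\<^sup>2) * g \<omega>) = 0" for x :: real
    by (rule integral_odd_eq_0) (simp add: even)
  then have root: "0 \<in> Kc_roots g f1"
    by (simp add: Kc_roots_def f1)
  have at0: "ereal (- Im f1) / ereal (pi * (cmod f1)\<^sup>2 * g 0) = ereal (2 / (pi * g 0))"
    using pos by (simp add: cmod f1 power_divide field_simps)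
  \<comment> \<open>The bound is shown for every real \<open>y\<close>, so the other roots need not
    be determined.\<close>
  have "ereal (2 / (pi * g 0)) \<le> ereal (- Im f1) / ereal (pi * (cmod f1)\<^sup>2 * g y)" for y
  proof (cases "g y = 0")
    case True
    \<comment> \<open>Here the quotient is a positive number divided by 0, which is \<infinity> in
      \<open>ereal\<close>.\<close>
    then show ?thesis
      by (simp add: f1 divide_ereal_def)
  next
    case False
    then have "0 < g y"
      using nonneg[of y] by simp
    then have "2 / (pi * g 0) \<le> 2 / (pi * g y)"
      using max[of y] pos by (intro divide_left_mono) auto
    then show ?thesis
      using \<open>0 < g y\<close> by (simp add: cmod f1 power_divide field_simps)
  qed
  then show ?thesis
    unfolding Kc1_def by (intro antisym INF_greatest INF_lower2[OF root] eq_refl[OF at0])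
qed

section \<open>The Poisson integral as a function of the growth rate\<close>

text \<open>This is \<open>pi\<close> times the harmonic extension of \<open>g\<close> to the upper
  half-plane, evaluated at height \<open>l\<close> above 0.\<close>

definition poisson_integral :: "(real \<Rightarrow> real) \<Rightarrow> real \<Rightarrow> real" where
  "poisson_integral g l = (LINT \<omega>|lborel. l / (l\<^sup>2 + \<omega>\<^sup>2) * g \<omega>)"

lemma poisson_kernel_le:
  fixes l \<omega> :: real
  assumes "0 < l"
  shows "l / (l\<^sup>2 + \<omega>\<^sup>2) \<le> 1 / l"
proof -
  have "l / (l\<^sup>2 + \<omega>\<^sup>2) \<le> l / l\<^sup>2"
    using assms by (intro divide_left_mono) (auto intro!: mult_pos_pos add_pos_nonneg)
  then show ?thesis
    using assms by (simp add: power2_eq_square)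
qed

lemma poisson_kernel_integrable:
  fixes g :: "real \<Rightarrow> real"
  assumes g: "integrable lborel g" and l: "0 < l"
  shows "integrable lborel (\<lambda>\<omega>. l / (l\<^sup>2 + \<omega>\<^sup>2) * g \<omega>)"
proof (rule Bochner_Integration.integrable_bound[OF integrable_mult_right[OF g, of "1 / l"]])
  have "\<bar>l / (l\<^sup>2 + \<omega>\<^sup>2)\<bar> * \<bar>g \<omega>\<bar> \<le> 1 / l * \<bar>g \<omega>\<bar>" for \<omega>
    using poisson_kernel_le[OF l, of \<omega>] l by (intro mult_right_mono) auto
  then show "AE \<omega> in lborel. norm (l / (l\<^sup>2 + \<omega>\<^sup>2) * g \<omega>) \<le> norm (1 / l * g \<omega>)"
    using l by (simp add: abs_mult)
qed (use g in measurable)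

text \<open>Supplies small values at large \<open>l\<close> for the intermediate value
  argument.\<close>

lemma poisson_integral_le:
  fixes g :: "real \<Rightarrow> real"
  assumes nonneg: "\<And>\<omega>. 0 \<le> g \<omega>" and g: "integrable lborel g" and l: "0 < l"
  shows "poisson_integral g l \<le> (LINT \<omega>|lborel. g \<omega>) / l"
proof -
  have "poisson_integral g l \<le> (LINT \<omega>|lborel. 1 / l * g \<omega>)"
    unfolding poisson_integral_def
    using poisson_kernel_integrable[OF g l] g nonneg poisson_kernel_le[OF l]
    by (intro integral_mono mult_right_mono) auto
  then show ?thesis
    by simp
qed

text \<open>Dominated convergence: staying above \<open>a > 0\<close> provides one integrable
  majorant, \<open>\<bar>g \<omega>\<bar> / a\<close>, for all rates.\<close>

lemma continuous_on_poisson_integral: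
  fixes g :: "real \<Rightarrow> real"
  assumes g: "integrable lborel g" and a: "0 < a"
  shows "continuous_on {a..} (poisson_integral g)"
  unfolding continuous_on_sequentially
proof (intro allI ballI impI, elim conjE)
  fix u :: "nat \<Rightarrow> real" and l
  assume l: "l \<in> {a..}" and u: "\<forall>n. u n \<in> {a..}" "u \<longlonglongrightarrow> l"
  have meas [measurable]: "g \<in> borel_measurable lborel"
    using g by simp
  have bound: "\<bar>u n / ((u n)\<^sup>2 + \<omega>\<^sup>2)\<bar> * \<bar>g \<omega>\<bar> \<le> 1 / a * \<bar>g \<omega>\<bar>" for n \<omega>
  proof (rule mult_right_mono)
    have "a \<le> u n"
      using u by auto
    then have "1 / u n \<le> 1 / a"
      using a by (simp add: frac_le)
    then show "\<bar>u n / ((u n)\<^sup>2 + \<omega>\<^sup>2)\<bar> \<le> 1 / a"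
      using poisson_kernel_le[of "u n" \<omega>] a \<open>a \<le> u n\<close> by simp
  qed simp
  have "(\<lambda>n. LINT \<omega>|lborel. u n / ((u n)\<^sup>2 + \<omega>\<^sup>2) * g \<omega>)
      \<longlonglongrightarrow> (LINT \<omega>|lborel. l / (l\<^sup>2 + \<omega>\<^sup>2) * g \<omega>)"
  proof (rule integral_dominated_convergence[where w = "\<lambda>\<omega>. 1 / a * \<bar>g \<omega>\<bar>"])
    show "integrable lborel (\<lambda>\<omega>. 1 / a * \<bar>g \<omega>\<bar>)"
      using g by simp
    have "(\<lambda>n. u n / ((u n)\<^sup>2 + \<omega>\<^sup>2) * g \<omega>) \<longlonglongrightarrow> l / (l\<^sup>2 + \<omega>\<^sup>2) * g \<omega>" for \<omega>
      using l a by (intro tendsto_intros u(2)) (auto simp: sum_power2_eq_zero_iff)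
    then show "AE \<omega> in lborel. (\<lambda>n. u n / ((u n)\<^sup>2 + \<omega>\<^sup>2) * g \<omega>) \<longlonglongrightarrow> l / (l\<^sup>2 + \<omega>\<^sup>2) * g \<omega>"
      by simp
    show "AE \<omega> in lborel. norm (u n / ((u n)\<^sup>2 + \<omega>\<^sup>2) * g \<omega>) \<le> 1 / a * \<bar>g \<omega>\<bar>" for n
      using bound by (simp add: abs_mult)
  qed measurable
  then show "(poisson_integral g \<circ> u) \<longlonglongrightarrow> poisson_integral g l"
    by (simp add: poisson_integral_def comp_def)
qed

text \<open>The kernel has the antiderivative \<open>arctan (\<omega> / l)\<close>. On
  \<open>{- d..d}\<close> the density is at least \<open>m\<close>, and the nonnegative rest of the
  integral is dropped. The bound tends to \<open>pi * m\<close> as \<open>l\<close> tends to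
  0.\<close>

lemma poisson_integral_ge_arctan:
  fixes g :: "real \<Rightarrow> real"
  assumes nonneg: "\<And>\<omega>. 0 \<le> g \<omega>" and g: "integrable lborel g" and l: "0 < l"
    and d: "0 < d" and m: "\<And>\<omega>. \<bar>\<omega>\<bar> \<le> d \<Longrightarrow> m \<le> g \<omega>"
  shows "m * (2 * arctan (d / l)) \<le> poisson_integral g l"
proof -
  have deriv: "((\<lambda>\<omega>. arctan (\<omega> / l)) has_real_derivative l / (l\<^sup>2 + \<omega>\<^sup>2)) (at \<omega>)" for \<omega>
  proof -
    have "((\<lambda>\<omega>. arctan (\<omega> / l)) has_real_derivative inverse (1 + (\<omega> / l)\<^sup>2) * (1 / l)) (at \<omega>)"
      using l by (auto intro!: derivative_eq_intros)
    moreover have "inverse (1 + (\<omega> / l)\<^sup>2) * (1 / l) = l / (l\<^sup>2 + \<omega>\<^sup>2)"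
    proof -
      have "1 + (\<omega> / l)\<^sup>2 = (l\<^sup>2 + \<omega>\<^sup>2) / l\<^sup>2"
        using l by (simp add: power_divide field_simps)
      then show ?thesis
        using l by (simp add: power2_eq_square)
    qed
    ultimately show ?thesis
      by simp
  qed
  have cont: "isCont (\<lambda>\<omega>. l / (l\<^sup>2 + \<omega>\<^sup>2)) \<omega>" for \<omega>
    using l by (intro continuous_intros) (auto simp: sum_power2_eq_zero_iff)
  have "has_bochner_integral lborel (\<lambda>\<omega>. l / (l\<^sup>2 + \<omega>\<^sup>2) * indicator {- d..d} \<omega>)
      (arctan (d / l) - arctan (- d / l))"
    using d by (intro has_bochner_integral_FTC_Icc_real deriv cont) simp
  then have fundamental: "integrable lborel (\<lambda>\<omega>. l / (l\<^sup>2 + \<omega>\<^sup>2) * indicator {- d..d} \<omega>)"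
      "(LINT \<omega>|lborel. l / (l\<^sup>2 + \<omega>\<^sup>2) * indicator {- d..d} \<omega>) = 2 * arctan (d / l)"
    by (auto simp: has_bochner_integral_iff arctan_minus)
  have "m * (l / (l\<^sup>2 + \<omega>\<^sup>2) * indicator {- d..d} \<omega>) \<le> l / (l\<^sup>2 + \<omega>\<^sup>2) * g \<omega>" for \<omega>
  proof (cases "\<omega> \<in> {- d..d}")
    case True
    then have "m \<le> g \<omega>"
      by (intro m) auto
    then have "l / (l\<^sup>2 + \<omega>\<^sup>2) * m \<le> l / (l\<^sup>2 + \<omega>\<^sup>2) * g \<omega>"
      using l by (intro mult_left_mono) auto
    with True show ?thesis
      by (simp add: mult.commute)
  qed (use nonneg l in auto)
  then have "(LINT \<omega>|lborel. m * (l / (l\<^sup>2 + \<omega>\<^sup>2) * indicator {- d..d} \<omega>)) \<le> poisson_integral g l"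
    unfolding poisson_integral_def
    by (intro integral_mono integrable_mult_right fundamental poisson_kernel_integrable g l)
  then show ?thesis
    by (simp only: integral_mult_right_zero fundamental)
qed

lemma poisson_integral_attains:
  fixes g :: "real \<Rightarrow> real"
  assumes nonneg: "\<And>\<omega>. 0 \<le> g \<omega>" and g: "integrable lborel g"
    and cont: "isCont g 0" and v: "0 < v" "v < pi * g 0"
  obtains l where "0 < l" "poisson_integral g l = v"
proof -
  \<comment> \<open>The upper gap lets continuity keep \<open>g\<close> above \<open>m\<close> near
    0; the lower gap leaves room for \<open>2 * arctan x\<close> to stay below
    \<open>pi\<close>.\<close>
  obtain m where m: "v / pi < m" "m < g 0"
    using dense[of "v / pi" "g 0"] v by (auto simp: field_simps)
  then have "0 < m"
    using v by (meson divide_pos_pos less_trans pi_gt_zero)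
  have "eventually (\<lambda>\<omega>. m < g \<omega>) (nhds 0)"
    using cont m(2) by (auto simp: isCont_def tendsto_nhds_iff intro: order_tendstoD)
  then obtain e where e: "0 < e" "\<And>\<omega>. \<bar>\<omega>\<bar> < e \<Longrightarrow> m < g \<omega>"
    by (auto simp: eventually_nhds_metric)
  define d where "d = e / 2"
  have d: "0 < d" "\<And>\<omega>. \<bar>\<omega>\<bar> \<le> d \<Longrightarrow> m \<le> g \<omega>"
    using e by (auto simp: d_def intro!: less_imp_le)
  have "((\<lambda>x. m * (2 * arctan x)) \<longlongrightarrow> m * (2 * (pi / 2))) at_top"
    by (intro tendsto_intros tendsto_arctan_at_top)
  moreover have "v < m * (2 * (pi / 2))"
    using m(1) by (simp add: field_simps)
  ultimately have "eventually (\<lambda>x. v < m * (2 * arctan x)) at_top"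
    by (rule order_tendstoD)
  then obtain x where x: "0 < x" "v < m * (2 * arctan x)"
    using eventually_happens[OF eventually_conj[OF _ eventually_gt_at_top[of 0]]] by auto
  \<comment> \<open>At this rate the arctan bound reads \<open>m * (2 * arctan x)\<close>, which
    exceeds \<open>v\<close>.\<close>
  define a where "a = d / x"
  have a: "0 < a" "d / a = x"
    using d x by (auto simp: a_def)
  have lower: "v \<le> poisson_integral g a"
    using poisson_integral_ge_arctan[of g a d m] nonneg g a d x by force
  \<comment> \<open>The second entry pushes the upper bound, total mass divided by \<open>b\<close>,
    down to \<open>v\<close>; the first keeps \<open>{a..b}\<close> a genuine interval.\<close>
  define b where "b = max a ((LINT \<omega>|lborel. g \<omega>) / v)"
  have b: "a \<le> b" "0 < b" "(LINT \<omega>|lborel. g \<omega>) / v \<le> b"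
    using a by (auto simp: b_def)
  then have "(LINT \<omega>|lborel. g \<omega>) / b \<le> v"
    using v by (simp add: field_simps)
  then have upper: "poisson_integral g b \<le> v"
    using poisson_integral_le[of g b] nonneg g b by force
  have "continuous_on {a..b} (poisson_integral g)"
    using continuous_on_poisson_integral[OF g a(1)] by (rule continuous_on_subset) auto
  from IVT2'[OF upper lower b(1) this] obtain l where "a \<le> l" "poisson_integral g l = v"
    by auto
  then show thesis
    using a by (intro that[of l]) auto
qed

section \<open>The weighted L^2 space\<close>

lemma integral_freq_measure:
  fixes h :: "real \<Rightarrow> complex"
  assumes nonneg: "\<And>\<omega>. 0 \<le> g \<omega>" and "g \<in> borel_measurable borel" "h \<in> borel_measurable borel"
  shows "(LINT \<omega>|freq_measure g. h \<omega>) = (LINT \<omega>|lborel. g \<omega> *\<^sub>R h \<omega>)"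
  unfolding freq_measure_def using assms by (intro integral_density) auto

lemma finite_measure_freq_measure:
  assumes nonneg: "\<And>\<omega>. 0 \<le> g \<omega>" and g: "integrable lborel g"
  shows "finite_measure (freq_measure g)"
proof
  have "emeasure (freq_measure g) (space (freq_measure g)) = (\<integral>\<^sup>+ \<omega>. ennreal (g \<omega>) \<partial>lborel)"
    using g by (simp add: freq_measure_def emeasure_density)
  also have "\<dots> = ennreal (LINT \<omega>|lborel. g \<omega>)"
    using g nonneg by (intro nn_integral_eq_integral) auto
  finally show "emeasure (freq_measure g) (space (freq_measure g)) \<noteq> \<infinity>"
    by simp
qed

text \<open>The measure has finite total mass, so a constant bound is square integrable.\<close>

lemma bounded_in_L2:
  assumes nonneg: "\<And>\<omega>. 0 \<le> g \<omega>" and g: "integrable lborel g"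
    and q: "q \<in> borel_measurable borel" and bound: "\<And>\<omega>. cmod (q \<omega>) \<le> B"
  shows "q \<in> L2 g"
proof -
  interpret finite_measure "freq_measure g"
    by (rule finite_measure_freq_measure[OF nonneg g])
  have "q \<in> borel_measurable (freq_measure g)"
    using q by (simp add: freq_measure_def)
  then have "integrable (freq_measure g) (\<lambda>\<omega>. (cmod (q \<omega>))\<^sup>2)"
    using bound by (intro integrable_const_bound[where B = "B\<^sup>2"]) (auto intro!: power_mono)
  then show ?thesis
    using q by (simp add: L2_def)
qed

lemma L2_norm_cmult: "L2_norm g (\<lambda>\<omega>. c * q \<omega>) = cmod c * L2_norm g q"
  by (simp add: L2_norm_def norm_mult power_mult_distrib real_sqrt_mult)

section \<open>Eigenvalues in the right half-plane\<close>

text \<open>Every time slice is a scalar multiple of \<open>q\<close>, so differentiability in the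
  L^2 norm reduces to that of the scalar exponential.\<close>

lemma exp_solution_of_eigenfunction:
  fixes l :: complex
  assumes dom: "q \<in> lin_dom g" and eigen: "\<And>\<omega>. lin_op g K f1 q \<omega> = l * q \<omega>"
  shows "lin_solution g K f1 (\<lambda>t \<omega>. c * exp (of_real t * l) * q \<omega>)"
  unfolding lin_solution_def
proof (intro allI impI conjI)
  fix t :: real
  assume "0 \<le> t"
  have L2_scale: "(\<lambda>\<omega>. b * p \<omega>) \<in> L2 g" if "p \<in> L2 g" for b p
    using that by (auto simp: L2_def norm_mult power_mult_distrib)
  show "(\<lambda>\<omega>. c * exp (of_real t * l) * q \<omega>) \<in> lin_dom g"
    using dom L2_scale[of q "c * exp (of_real t * l)"]
      L2_scale[of "mult_op q" "c * exp (of_real t * l)"]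
    by (simp add: lin_dom_def mult_op_def mult.left_commute)
  have lin: "lin_op g K f1 (\<lambda>\<omega>. b * q \<omega>) \<omega> = b * l * q \<omega>" for b \<omega>
  proof -
    have "lin_op g K f1 (\<lambda>\<omega>. b * q \<omega>) \<omega> = b * lin_op g K f1 q \<omega>"
      by (simp add: lin_op_def mult_op_def proj_op_def algebra_simps)
    then show ?thesis
      by (simp add: eigen)
  qed
  let ?e = "\<lambda>s::real. c * exp (of_real s * l)"
  have "((\<lambda>z. c * exp (z * l)) has_field_derivative ?e t * l) (at (of_real t))"
    by (auto intro!: derivative_eq_intros)
  then have "((\<lambda>z. (c * exp (z * l) - ?e t) / (z - of_real t)) \<longlongrightarrow> ?e t * l) (at (of_real t))"
    by (simp add: has_field_derivative_iff)
  \<comment> \<open>Restricts the complex derivative to real times \<open>s \<ge> 0\<close>, which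
    includes the one-sided case \<open>t = 0\<close>.\<close>
  moreover have "filterlim complex_of_real (at (of_real t)) (at t within {0..})"
    by (auto simp: eventually_at_filter intro!: filterlim_atI tendsto_intros)
  ultimately have "((\<lambda>s. (?e s - ?e t) / (of_real s - of_real t)) \<longlongrightarrow> ?e t * l) (at t within {0..})"
    by (rule filterlim_compose)
  then have "((\<lambda>s. (?e s - ?e t) / of_real (s - t) - ?e t * l) \<longlongrightarrow> 0) (at t within {0..})"
    by (simp add: LIM_zero_iff)
  then have lim: "((\<lambda>s. cmod ((?e s - ?e t) / of_real (s - t) - ?e t * l) * L2_norm g q)
      \<longlongrightarrow> 0) (at t within {0..})"
    by (intro tendsto_mult_left_zero tendsto_norm_zero)
  \<comment> \<open>The error is a scalar times \<open>q\<close>, and its norm is the expression in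
    \<open>lim\<close>.\<close>
  have "(\<lambda>\<omega>. (?e s * q \<omega> - ?e t * q \<omega>) / of_real (s - t)
        - lin_op g K f1 (\<lambda>\<omega>. ?e t * q \<omega>) \<omega>)
      = (\<lambda>\<omega>. ((?e s - ?e t) / of_real (s - t) - ?e t * l) * q \<omega>)" for s
    by (simp only: lin) (simp add: diff_divide_distrib algebra_simps)
  then show "((\<lambda>s. L2_norm g (\<lambda>\<omega>. (?e s * q \<omega> - ?e t * q \<omega>) / of_real (s - t)
        - lin_op g K f1 (\<lambda>\<omega>. ?e t * q \<omega>) \<omega>)) \<longlongrightarrow> 0) (at t within {0..})"
    using lim by (simp only: L2_norm_cmult)
qed

text \<open>The norm of the exponential solution grows like \<open>exp (t * Re l)\<close> however
  small its initial value, which refutes stability with \<epsilon> = 1.\<close>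

lemma zero_unstable_of_eigenvalue:
  fixes l :: complex
  assumes dom: "q \<in> lin_dom g" and eigen: "\<And>\<omega>. lin_op g K f1 q \<omega> = l * q \<omega>"
    and l: "0 < Re l" and q: "0 < L2_norm g q"
  shows "zero_unstable g K f1"
  unfolding zero_unstable_def
proof
  assume "zero_stable g K f1"
  then obtain d where d: "0 < d" and stable:
    "\<And>Z t. lin_solution g K f1 Z \<Longrightarrow> L2_norm g (Z 0) < d \<Longrightarrow> 0 \<le> t \<Longrightarrow> L2_norm g (Z t) < 1"
    unfolding zero_stable_def by (metis zero_less_one)
  \<comment> \<open>Scales the initial norm to \<open>d / 2\<close>.\<close>
  define c where "c = d / (2 * L2_norm g q)"
  have c: "0 < c"
    using d q by (simp add: c_def)
  let ?Z = "\<lambda>t \<omega>. complex_of_real c * exp (of_real t * l) * q \<omega>"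
  have norm: "L2_norm g (?Z t) = exp (t * Re l) * (d / 2)" for t
    using c q by (simp add: L2_norm_cmult norm_mult) (simp add: c_def)
  have "lin_solution g K f1 ?Z"
    by (rule exp_solution_of_eigenfunction[OF dom eigen])
  moreover have "L2_norm g (?Z 0) < d"
    using d by (simp only: norm) simp
  ultimately have small: "exp (t * Re l) * (d / 2) < 1" if "0 \<le> t" for t
    using stable[of ?Z t] that by (simp only: norm)
  \<comment> \<open>At this time the growth factor is \<open>exp (2 / d) \<ge> 2 / d\<close>, so the
    norm has reached 1.\<close>
  define t where "t = 2 / d / Re l"
  have "2 / d \<le> exp (2 / d)"
    using exp_ge_add_one_self[of "2 / d"] by linarith
  then have "1 \<le> exp (t * Re l) * (d / 2)"
    using l d by (simp add: t_def field_simps)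
  moreover have "0 \<le> t"
    using l d by (simp add: t_def)
  ultimately show False
    using small[of t] by simp
qed

text \<open>Since \<open>\<i> * K * f1 = K / 2\<close>, a function of mean \<open>2 / K\<close> has
  coupling term 1, and the eigenvalue equation becomes
  \<open>(l - \<i> * \<omega>) * q \<omega> = 1\<close>.\<close>

lemma zero_unstable_of_poisson_integral:
  assumes nonneg: "\<And>\<omega>. 0 \<le> g \<omega>" and g: "integrable lborel g" and even: "\<And>\<omega>. g (- \<omega>) = g \<omega>"
    and K: "0 < K" and f1: "Re f1 = 0" "Im f1 = - 1 / 2"
    and l: "0 < l" and eq: "poisson_integral g l = 2 / K"
  shows "zero_unstable g K f1"
proof -
  define q where "q \<omega> = 1 / Complex l (- \<omega>)" for \<omega>
  have [measurable]: "g \<in> borel_measurable borel"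
    using g by simp
  have nz: "Complex l (- \<omega>) \<noteq> 0" "l\<^sup>2 + \<omega>\<^sup>2 \<noteq> 0" for \<omega>
    using l by (auto simp: complex_eq_iff sum_power2_eq_zero_iff)
  have parts: "q \<omega> = Complex (l / (l\<^sup>2 + \<omega>\<^sup>2)) (\<omega> / (l\<^sup>2 + \<omega>\<^sup>2))" for \<omega>
    by (simp add: q_def complex_eq_iff Re_divide Im_divide)
  have qmeas [measurable]: "q \<in> borel_measurable borel"
    unfolding borel_measurable_complex_iff by (simp add: parts)
  \<comment> \<open>The modulus of \<open>l - \<i> * \<omega>\<close> dominates both
    \<open>l\<close> and \<open>\<bar>\<omega>\<bar>\<close>. So \<open>q\<close> and
    \<open>\<omega> * q \<omega>\<close> are bounded, which puts \<open>q\<close> in the domain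
    without any moment condition on \<open>g\<close>.\<close>
  have bound: "cmod (q \<omega>) \<le> 1 / l" for \<omega>
  proof -
    have "l \<le> cmod (Complex l (- \<omega>))"
      using complex_Re_le_cmod[of "Complex l (- \<omega>)"] by simp
    then show ?thesis
      using l by (simp add: q_def norm_divide frac_le)
  qed
  have "cmod (of_real \<omega> * q \<omega>) \<le> 1" for \<omega>
  proof -
    have "\<bar>\<omega>\<bar> \<le> cmod (Complex l (- \<omega>))"
      using abs_Im_le_cmod[of "Complex l (- \<omega>)"] by simp
    then show ?thesis
      using nz(1)[of \<omega>] by (simp add: q_def norm_divide norm_mult divide_le_eq_1)
  qed
  then have "mult_op q \<in> L2 g"
    by (intro bounded_in_L2[OF nonneg g]) (auto simp: mult_op_def[abs_def])
  moreover have "q \<in> L2 g"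
    by (rule bounded_in_L2[OF nonneg g qmeas bound])
  ultimately have dom: "q \<in> lin_dom g"
    by (simp add: lin_dom_def)
  have int: "integrable lborel (\<lambda>\<omega>. g \<omega> *\<^sub>R q \<omega>)"
  proof (rule Bochner_Integration.integrable_bound[OF integrable_mult_right[OF g, of "1 / l"]])
    have "\<bar>g \<omega>\<bar> * cmod (q \<omega>) \<le> \<bar>g \<omega>\<bar> * (1 / l)" for \<omega>
      by (intro mult_left_mono bound) simp
    then show "AE \<omega> in lborel. norm (g \<omega> *\<^sub>R q \<omega>) \<le> norm (1 / l * g \<omega>)"
      using l by (simp add: abs_mult)
  qed measurable
  have mean: "(LINT \<omega>|freq_measure g. q \<omega>) = of_real (2 / K)"
  proof (rule complex_eqI)
    have *: "(LINT \<omega>|freq_measure g. q \<omega>) = (LINT \<omega>|lborel. g \<omega> *\<^sub>R q \<omega>)"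
      by (rule integral_freq_measure[OF nonneg]) measurable
    show "Re (LINT \<omega>|freq_measure g. q \<omega>) = Re (of_real (2 / K))"
      unfolding * integral_Re[OF int, symmetric] using eq
      by (simp add: parts poisson_integral_def mult.commute)
    \<comment> \<open>The imaginary part of \<open>q\<close> is odd and \<open>g\<close> is
      even.\<close>
    have "(LINT \<omega>|lborel. Im (g \<omega> *\<^sub>R q \<omega>)) = 0"
      by (rule integral_odd_eq_0) (simp add: parts even)
    then show "Im (LINT \<omega>|freq_measure g. q \<omega>) = Im (of_real (2 / K))"
      unfolding * integral_Im[OF int, symmetric] by simp
  qed
  have f1': "f1 = - \<i> / 2"
    by (simp add: complex_eq_iff f1)
  have eigen: "lin_op g K f1 q \<omega> = of_real l * q \<omega>" for \<omega>
  proof -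
    have "(of_real l - \<i> * of_real \<omega>) * q \<omega> = 1"
      using nz(1)[of \<omega>] by (simp add: q_def Complex_eq)
    moreover have "\<i> * of_real K * f1 * of_real (2 / K) = 1"
      using K by (simp add: f1')
    ultimately show ?thesis
      by (simp add: lin_op_def mult_op_def proj_op_def mean algebra_simps)
  qed
  \<comment> \<open>A null function would have mean 0 instead of \<open>2 / K\<close>.\<close>
  have "L2_norm g q \<noteq> 0"
  proof
    assume "L2_norm g q = 0"
    then have "AE \<omega> in freq_measure g. (cmod (q \<omega>))\<^sup>2 = 0"
      using \<open>q \<in> L2 g\<close> integral_nonneg_eq_0_iff_AE[of "freq_measure g" "\<lambda>\<omega>. (cmod (q \<omega>))\<^sup>2"]
      by (simp add: L2_norm_def L2_def)
    then have "(LINT \<omega>|freq_measure g. q \<omega>) = 0"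
      by (intro integral_eq_zero_AE) auto
    then show False
      using mean K by simp
  qed
  then have "0 < L2_norm g q"
    by (simp add: L2_norm_def less_le)
  then show ?thesis
    using zero_unstable_of_eigenvalue[OF dom eigen] l by simp
qed

text \<open>Continuity at 0 guards the instability claim because raising \<open>g\<close> at the
  single point 0 lowers \<open>2 / (pi * g 0)\<close> but leaves the L^2 equation unchanged.\<close>

theorem corollary3p6:
  fixes g f :: "real \<Rightarrow> real" and K :: real and f1 :: complex
  assumes "\<And>\<omega>. 0 \<le> g \<omega>"
    and "integrable lborel g"
    and "(LINT \<omega>|lborel. g \<omega>) = 1"
    and "K > 0"
    and "f C1_differentiable_on UNIV"
    and "\<And>\<theta>. f (\<theta> + 2 * pi) = f \<theta>"
    and "fourier_coeff f 0 = 0"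
    and "f1 = fourier_coeff f 1"
    and "\<And>\<omega>. g (- \<omega>) = g \<omega>"
    and "\<And>\<omega>. g \<omega> \<le> g 0"
    and "Re f1 = 0"
    and "Im f1 = - 1 / 2"
  shows "Kc1 g f1 = ereal (2 / (pi * g 0)) \<and>
    (isCont g 0 \<longrightarrow> ereal K > Kc1 g f1 \<longrightarrow> zero_unstable g K f1)"
proof (intro conjI impI)
  \<comment> \<open>Otherwise the maximum at 0 would force \<open>g\<close> to vanish identically,
    against total mass 1.\<close>
  have pos: "0 < g 0"
  proof (rule ccontr)
    assume "\<not> 0 < g 0"
    then have "g \<omega> = 0" for \<omega>
      using assms(1)[of \<omega>] assms(10)[of \<omega>] by simp
    with assms(3) show False
      by simp
  qed
  show Kc: "Kc1 g f1 = ereal (2 / (pi * g 0))"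
    by (rule Kc1_eq[OF assms(1,9,10) pos assms(11,12)])
  assume cont: "isCont g 0" and "ereal K > Kc1 g f1"
  then have "2 / (pi * g 0) < K"
    by (simp add: Kc)
  then have "2 / K < pi * g 0"
    using pos assms(4) by (simp add: field_simps)
  then obtain l where "0 < l" "poisson_integral g l = 2 / K"
    using poisson_integral_attains[OF assms(1,2) cont, of "2 / K"] assms(4) by auto
  then show "zero_unstable g K f1"
    by (intro zero_unstable_of_poisson_integral[OF assms(1,2,9,4,11,12)])
qed

end
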